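(* Let $\theta\in\Theta=\nu\,\mathbb{C}[[\nu]]$, let $A=C^\infty(M_3)$ with the action of the operators $\mathfrak{p},\mathfrak{q},\mathfrak{t}$, and let $A_{\mathrm{hol}}:=\{f\in A:\mathfrak{q}f=0\}$. Then $a\ast_\theta b=ab$ (pointwise product) for all $a,b\in A_{\mathrm{hol}}[[\nu]]$, and $A_{\mathrm{hol}}^\theta:=(A_{\mathrm{hol}}[[\nu]],\ast_\theta)$ is a commutative associative subalgebra of $A^\theta=(A[[\nu]],\ast_\theta)$.
   Context: Let $\tau\in\mathbb{C}$ with $\Im(\tau)>0$. The Heisenberg group is realized as $H_3(\mathbb{R}):=\mathbb{C}\times\mathbb{R}$ with multiplication $(z_1,t_1)\cdot(z_2,t_2)=(z_1+z_2,\,t_1+t_2+\Im(\bar z_1z_2))$, and $H_3(\mathbb{Z})\subset H_3(\mathbb{R})$ is the subgroup generated by $(1,0)$ and $(\tau,0)$. $M_3:=H_3(\mathbb{R})/H_3(\mathbb{Z})$, and $A:=C^\infty(M_3)$ (with pointwise product) is identified with the smooth complex functions on $H_3(\mathbb{R})$ that are invariant under right multiplication by $H_3(\mathbb{Z})$. The right invariant vector fields $$\mathfrak{p}=\sqrt{\tfrac{\Im(\tau)}{\pi}}\Big(\tfrac{\partial}{\partial z}+\tfrac{i\bar z}{2}\tfrac{\partial}{\partial t}\Big),\quad \mathfrak{q}=\sqrt{\tfrac{\Im(\tau)}{\pi}}\Big(\tfrac{\partial}{\partial\bar z}-\tfrac{iz}{2}\tfrac{\partial}{\partial t}\Big),\quad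 \mathfrak{t}=\tfrac{\Im(\tau)}{\pi i}\tfrac{\partial}{\partial t}$$ act on $A$ by derivations and satisfy $[\mathfrak{p},\mathfrak{q}]=\mathfrak{t}$ with $\mathfrak{t}$ central. For $\theta\in\Theta:=\nu\,\mathbb{C}[[\nu]]$, the ($\mathbb{C}[[\nu]]$-bilinear, in general non-associative) product on $A[[\nu]]$ is $a\ast_\theta b:=\sum_{j\ge 0}\frac{(-\theta)^j}{j!}(\mathfrak{p}^ja)(\mathfrak{q}^jb)$. *)

theory Defs
  imports
    "HOL-Analysis.Analysis"
    "HOL-Algebra.Generated_Groups"
    "HOL-Computational_Algebra.Formal_Power_Series"
    "HOL-Library.Function_Algebras"
begin

section \<open>The Heisenberg group and its lattice\<close>

definition heis :: "(complex \<times> real) monoid" where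
  "heis = \<lparr>carrier = UNIV,
           mult = (\<lambda>(z1, t1) (z2, t2). (z1 + z2, t1 + t2 + Im (cnj z1 * z2))),
           one = (0, 0)\<rparr>"

lemma group_heis: "group heis"
proof (rule groupI)
  fix x assume "x \<in> carrier heis"
  show "\<exists>y\<in>carrier heis. y \<otimes>\<^bsub>heis\<^esub> x = \<one>\<^bsub>heis\<^esub>"
    by (rule bexI[of _ "(- fst x, - snd x)"]) (auto simp: heis_def split: prod.splits)
qed (auto simp: heis_def algebra_simps split: prod.splits)

definition heis_lattice :: "complex \<Rightarrow> (complex \<times> real) set" where
  "heis_lattice \<tau> = generate heis {(1, 0), (\<tau>, 0)}"


section \<open>Smooth functions on the Heisenberg nilmanifold\<close>

primrec k_smooth :: "nat \<Rightarrow> ('a::real_normed_vector \<Rightarrow> 'b::real_normed_vector) \<Rightarrow> bool" where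
  "k_smooth 0 f \<longleftrightarrow> continuous_on UNIV f"
| "k_smooth (Suc k) f \<longleftrightarrow>
     (\<forall>x. f differentiable (at x)) \<and> (\<forall>v. k_smooth k (\<lambda>x. frechet_derivative f (at x) v))"

definition smooth :: "('a::real_normed_vector \<Rightarrow> 'b::real_normed_vector) \<Rightarrow> bool" where
  "smooth f \<longleftrightarrow> (\<forall>k. k_smooth k f)"

text \<open>Smooth functions on the quotient by \<open>heis_lattice \<tau>\<close> are identified with the smooth
  functions on the group that are invariant under right multiplication by the lattice.\<close>

definition A_smooth :: "complex \<Rightarrow> (complex \<times> real \<Rightarrow> complex) set" where
  "A_smooth \<tau> = {f. smooth f \<and> (\<forall>h\<in>heis_lattice \<tau>. \<forall>x. f (x \<otimes>\<^bsub>heis\<^esub> h) = f x)}"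


section \<open>The vector fields\<close>

definition partial_x :: "(complex \<times> real \<Rightarrow> complex) \<Rightarrow> complex \<times> real \<Rightarrow> complex" where
  "partial_x f w = frechet_derivative f (at w) (1, 0)"

definition partial_y :: "(complex \<times> real \<Rightarrow> complex) \<Rightarrow> complex \<times> real \<Rightarrow> complex" where
  "partial_y f w = frechet_derivative f (at w) (\<i>, 0)"

definition partial_t :: "(complex \<times> real \<Rightarrow> complex) \<Rightarrow> complex \<times> real \<Rightarrow> complex" where
  "partial_t f w = frechet_derivative f (at w) (0, 1)"

definition partial_z :: "(complex \<times> real \<Rightarrow> complex) \<Rightarrow> complex \<times> real \<Rightarrow> complex" where
  "partial_z f w = (partial_x f w - \<i> * partial_y f w) / 2"

definition partial_zbar :: "(complex \<times> real \<Rightarrow> complex) \<Rightarrow> complex \<times> real \<Rightarrow> complex" where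
  "partial_zbar f w = (partial_x f w + \<i> * partial_y f w) / 2"

definition vf_p :: "complex \<Rightarrow> (complex \<times> real \<Rightarrow> complex) \<Rightarrow> complex \<times> real \<Rightarrow> complex" where
  "vf_p \<tau> f w = complex_of_real (sqrt (Im \<tau> / pi)) *
     (partial_z f w + \<i> * cnj (fst w) / 2 * partial_t f w)"

definition vf_q :: "complex \<Rightarrow> (complex \<times> real \<Rightarrow> complex) \<Rightarrow> complex \<times> real \<Rightarrow> complex" where
  "vf_q \<tau> f w = complex_of_real (sqrt (Im \<tau> / pi)) *
     (partial_zbar f w - \<i> * fst w / 2 * partial_t f w)"

definition vf_t :: "complex \<Rightarrow> (complex \<times> real \<Rightarrow> complex) \<Rightarrow> complex \<times> real \<Rightarrow> complex" where
  "vf_t \<tau> f w = complex_of_real (Im \<tau>) / (complex_of_real pi * \<i>) * partial_t f w"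

definition A_hol :: "complex \<Rightarrow> (complex \<times> real \<Rightarrow> complex) set" where
  "A_hol \<tau> = {f \<in> A_smooth \<tau>. vf_q \<tau> f = 0}"


section \<open>Formal power series in the deformation parameter\<close>

text \<open>The formal parameter is \<open>fps_X\<close>. Functions carry the pointwise ring structure, so the
  product of \<open>(complex \<times> real \<Rightarrow> complex) fps\<close> is the extension of the pointwise product to
  formal power series.\<close>

definition Theta :: "complex fps set" where
  "Theta = range (\<lambda>c. fps_X * c)"

definition fps_over :: "'a set \<Rightarrow> 'a fps set" where
  "fps_over V = {a. \<forall>n. fps_nth a n \<in> V}"

definition fps_map :: "('a \<Rightarrow> 'b) \<Rightarrow> 'a fps \<Rightarrow> 'b fps" where
  "fps_map f a = Abs_fps (\<lambda>n. f (fps_nth a n))"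

text \<open>Scalar series act through their embedding as series of constant functions.\<close>

definition fps_scale :: "complex fps \<Rightarrow> ('c \<Rightarrow> complex) fps \<Rightarrow> ('c \<Rightarrow> complex) fps" where
  "fps_scale c a = fps_map (\<lambda>x _. x) c * a"

lemma sum_fun_apply: "(sum f S :: 'a \<Rightarrow> complex) w = (\<Sum>i\<in>S. f i w)"
  by (induction S rule: infinite_finite_induct) auto

lemma fps_nth_fps_scale:
  "fps_nth (fps_scale c a) n = (\<lambda>w. \<Sum>i=0..n. fps_nth c i * fps_nth a (n - i) w)"
  by (simp add: fps_scale_def fps_map_def fps_mult_nth times_fun_def fun_eq_iff sum_fun_apply)

lemma module_fps_scale: "Modules.module fps_scale"
proof
  have add: "fps_map (\<lambda>x _. x) (c + d) = fps_map (\<lambda>x _. x) c + fps_map (\<lambda>x _. x) d"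
    for c d :: "complex fps"
    by (simp add: fps_map_def fps_eq_iff plus_fun_def)
  have mult: "fps_map (\<lambda>x _. x) (c * d) = fps_map (\<lambda>x _. x) c * fps_map (\<lambda>x _. x) d"
    for c d :: "complex fps"
    by (simp add: fps_map_def fps_eq_iff fps_mult_nth times_fun_def fun_eq_iff sum_fun_apply)
  have one: "fps_map (\<lambda>x _. x) (1 :: complex fps) = 1"
    by (simp add: fps_map_def fps_eq_iff fun_eq_iff)
  fix c d :: "complex fps" and a b :: "('c \<Rightarrow> complex) fps"
  show "fps_scale c (a + b) = fps_scale c a + fps_scale c b"
    by (simp add: fps_scale_def distrib_left)
  show "fps_scale (c + d) a = fps_scale c a + fps_scale d a"
    by (simp add: fps_scale_def add distrib_right)
  show "fps_scale c (fps_scale d a) = fps_scale (c * d) a"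
    by (simp add: fps_scale_def mult mult.assoc)
  show "fps_scale 1 a = a"
    by (simp add: fps_scale_def one)
qed

text \<open>The sum converges with respect to the metric of \<open>'a fps\<close>, i.e. adically in
  \<open>fps_X\<close>; see \<open>star_summable\<close> below.\<close>

definition star_term :: "complex \<Rightarrow> complex fps \<Rightarrow> (complex \<times> real \<Rightarrow> complex) fps \<Rightarrow>
    (complex \<times> real \<Rightarrow> complex) fps \<Rightarrow> nat \<Rightarrow> (complex \<times> real \<Rightarrow> complex) fps" where
  "star_term \<tau> \<theta> a b j =
     fps_scale (fps_const (1 / fact j) * (- \<theta>) ^ j)
       (fps_map (vf_p \<tau> ^^ j) a * fps_map (vf_q \<tau> ^^ j) b)"

definition star :: "complex \<Rightarrow> complex fps \<Rightarrow> (complex \<times> real \<Rightarrow> complex) fps \<Rightarrow>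
    (complex \<times> real \<Rightarrow> complex) fps \<Rightarrow> (complex \<times> real \<Rightarrow> complex) fps" where
  "star \<tau> \<theta> a b = (\<Sum>j. star_term \<tau> \<theta> a b j)"

lemma fps_nth_star_term:
  assumes "\<theta> \<in> Theta" "n < j"
  shows "fps_nth (star_term \<tau> \<theta> a b j) n = 0"
proof -
  obtain c where c: "\<theta> = fps_X * c"
    using assms(1) by (auto simp: Theta_def)
  have "(- \<theta>) ^ j = fps_X ^ j * (- c) ^ j"
    by (simp add: c flip: power_mult_distrib)
  then have "fps_nth (fps_const (1 / fact j) * (- \<theta>) ^ j) i = 0" if "i < j" for i
    using that by (simp add: fps_X_power_mult_nth)
  then show ?thesis
    using assms(2) by (simp add: star_term_def fps_nth_fps_scale fun_eq_iff)
qed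

lemma star_sums:
  assumes "\<theta> \<in> Theta"
  shows "star_term \<tau> \<theta> a b sums
    Abs_fps (\<lambda>n. \<Sum>j\<le>n. fps_nth (star_term \<tau> \<theta> a b j) n)"
  unfolding sums_def tendsto_fps_iff
proof
  fix n
  have *: "fps_nth (\<Sum>j<m. star_term \<tau> \<theta> a b j) n =
      (\<Sum>j\<le>n. fps_nth (star_term \<tau> \<theta> a b j) n)" if "m > n" for m
    unfolding fps_sum_nth
    by (rule sum.mono_neutral_right) (use that assms in \<open>auto intro!: fps_nth_star_term\<close>)
  show "\<forall>\<^sub>F m in sequentially. fps_nth (\<Sum>j<m. star_term \<tau> \<theta> a b j) n =
      fps_nth (Abs_fps (\<lambda>n. \<Sum>j\<le>n. fps_nth (star_term \<tau> \<theta> a b j) n)) n"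
    using eventually_gt_at_top[of n] by eventually_elim (simp add: *)
qed

lemma star_summable: "\<theta> \<in> Theta \<Longrightarrow> summable (star_term \<tau> \<theta> a b)"
  using star_sums by (rule sums_summable)


section \<open>Algebras over a commutative ring, not necessarily associative or unital\<close>

definition algebra_on ::
  "('s::comm_ring_1 \<Rightarrow> 'm::ab_group_add \<Rightarrow> 'm) \<Rightarrow> ('m \<Rightarrow> 'm \<Rightarrow> 'm) \<Rightarrow> 'm set \<Rightarrow> bool" where
  "algebra_on act m V \<longleftrightarrow>
     Modules.module act \<and> module.subspace act V \<and>
     (\<forall>a\<in>V. \<forall>b\<in>V. m a b \<in> V) \<and>
     (\<forall>a\<in>V. \<forall>b\<in>V. \<forall>c\<in>V. m (a + b) c = m a c + m b c \<and> m a (b + c) = m a b + m a c) \<and>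
     (\<forall>s. \<forall>a\<in>V. \<forall>b\<in>V. m (act s a) b = act s (m a b) \<and> m a (act s b) = act s (m a b))"

definition subalgebra_on ::
  "('s::comm_ring_1 \<Rightarrow> 'm::ab_group_add \<Rightarrow> 'm) \<Rightarrow> ('m \<Rightarrow> 'm \<Rightarrow> 'm) \<Rightarrow> 'm set \<Rightarrow> 'm set \<Rightarrow> bool" where
  "subalgebra_on act m W V \<longleftrightarrow> algebra_on act m V \<and> algebra_on act m W \<and> W \<subseteq> V"

end

(* The vector fields p and q commute with right translations, so they preserve A and are linear;
   this makes A[[nu]] an algebra under the star product.  The kernel of the derivation q is
   closed under pointwise multiplication, and on it every term of the star product with j > 0
   contains a factor q^j b = 0. *)

theory Submission
  imports Defs
begin

section \<open>Smooth functions\<close>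

lemma frechet_derivative_add:
  assumes "f differentiable (at x)" "g differentiable (at x)"
  shows "frechet_derivative (\<lambda>x. f x + g x) (at x) v =
    frechet_derivative f (at x) v + frechet_derivative g (at x) v"
  by (subst frechet_derivative_at
        [OF has_derivative_add[OF assms[unfolded frechet_derivative_works]], symmetric]) (rule refl)

lemma frechet_derivative_times:
  fixes f g :: "'a::real_normed_vector \<Rightarrow> 'b::real_normed_algebra"
  assumes "f differentiable (at x)" "g differentiable (at x)"
  shows "frechet_derivative (\<lambda>x. f x * g x) (at x) v =
    f x * frechet_derivative g (at x) v + frechet_derivative f (at x) v * g x"
  by (subst frechet_derivative_at
        [OF has_derivative_mult[OF assms[unfolded frechet_derivative_works]], symmetric]) (rule refl)

lemma k_smooth_Suc_imp: "k_smooth (Suc k) f \<Longrightarrow> k_smooth k f"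
proof (induction k arbitrary: f)
  case 0
  then show ?case
    by (auto simp: continuous_on_eq_continuous_at intro: differentiable_imp_continuous_within)
next
  case (Suc k)
  then show ?case
    by (metis k_smooth.simps(2))
qed

lemma k_smooth_const: "k_smooth k (\<lambda>x. c)"
  by (induction k arbitrary: c) auto

text \<open>Every directional derivative is constant. This covers z and its conjugate, the
  coefficients of the t-derivative in the vector fields.\<close>

lemma k_smooth_bounded_linear: "bounded_linear f \<Longrightarrow> k_smooth k f"
proof (cases k)
  case (Suc k')
  assume f: "bounded_linear f"
  then have "frechet_derivative f (at x) = f" for x
    by (metis bounded_linear_imp_has_derivative frechet_derivative_at)
  with f Suc show ?thesis
    by (simp add: k_smooth_const bounded_linear_imp_differentiable)
qed (simp add: linear_continuous_on)

lemma k_smooth_add: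
  "k_smooth k f \<Longrightarrow> k_smooth k g \<Longrightarrow> k_smooth k (\<lambda>x. f x + g x)"
proof (induction k arbitrary: f g)
  case 0
  then show ?case by (simp add: continuous_on_add)
next
  case (Suc k)
  then show ?case by (auto simp: frechet_derivative_add)
qed

lemma k_smooth_mult:
  fixes f g :: "'a::real_normed_vector \<Rightarrow> 'b::real_normed_algebra"
  shows "k_smooth k f \<Longrightarrow> k_smooth k g \<Longrightarrow> k_smooth k (\<lambda>x. f x * g x)"
proof (induction k arbitrary: f g)
  case 0
  then show ?case by (simp add: continuous_on_mult)
next
  case (Suc k)
  \<comment> \<open>The product rule leaves \<open>f\<close> and \<open>g\<close> themselves as
    factors next to the derivatives, so they too are needed at order \<open>k\<close>.\<close>
  have "k_smooth k f" "k_smooth k g"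
    using Suc.prems by (blast intro: k_smooth_Suc_imp)+
  with Suc show ?case
    by (auto simp: frechet_derivative_times intro!: k_smooth_add)
qed

lemma smooth_const: "smooth (\<lambda>x. c)"
  by (simp add: smooth_def k_smooth_const)

lemma smooth_bounded_linear: "bounded_linear f \<Longrightarrow> smooth f"
  by (simp add: smooth_def k_smooth_bounded_linear)

lemma smooth_add: "smooth f \<Longrightarrow> smooth g \<Longrightarrow> smooth (\<lambda>x. f x + g x)"
  by (simp add: smooth_def k_smooth_add)

lemma smooth_mult:
  fixes f g :: "'a::real_normed_vector \<Rightarrow> 'b::real_normed_algebra"
  shows "smooth f \<Longrightarrow> smooth g \<Longrightarrow> smooth (\<lambda>x. f x * g x)"
  by (simp add: smooth_def k_smooth_mult)

lemma smooth_imp_differentiable: "smooth f \<Longrightarrow> f differentiable (at x)"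
  by (metis k_smooth.simps(2) smooth_def)

lemma smooth_frechet_derivative: "smooth f \<Longrightarrow> smooth (\<lambda>x. frechet_derivative f (at x) v)"
  by (metis k_smooth.simps(2) smooth_def)


section \<open>The vector fields\<close>

lemmas vf_defs = vf_p_def vf_q_def partial_z_def partial_zbar_def
  partial_x_def partial_y_def partial_t_def

lemma vf_add:
  assumes "smooth f" "smooth g"
  shows vf_p_add: "vf_p \<tau> (f + g) = vf_p \<tau> f + vf_p \<tau> g"
    and vf_q_add: "vf_q \<tau> (f + g) = vf_q \<tau> f + vf_q \<tau> g"
  using assms
  by (auto simp: fun_eq_iff vf_defs plus_fun_def frechet_derivative_add smooth_imp_differentiable
      algebra_simps add_divide_distrib diff_divide_distrib)

lemma vf_q_mult:
  assumes "smooth f" "smooth g"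
  shows "vf_q \<tau> (f * g) = f * vf_q \<tau> g + vf_q \<tau> f * g"
  using assms
  by (auto simp: fun_eq_iff vf_defs times_fun_def plus_fun_def frechet_derivative_times
      smooth_imp_differentiable algebra_simps add_divide_distrib diff_divide_distrib)

lemma vf_scale:
  assumes "smooth f"
  shows vf_p_scale: "vf_p \<tau> (\<lambda>w. c * f w) = (\<lambda>w. c * vf_p \<tau> f w)"
    and vf_q_scale: "vf_q \<tau> (\<lambda>w. c * f w) = (\<lambda>w. c * vf_q \<tau> f w)"
  using assms
  by (auto simp: fun_eq_iff vf_defs frechet_derivative_times smooth_imp_differentiable
      algebra_simps add_divide_distrib diff_divide_distrib)

lemma vf_q_zero: "vf_q \<tau> 0 = 0"
  by (simp add: fun_eq_iff vf_defs zero_fun_def)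

lemma smooth_vf:
  assumes "smooth f"
  shows smooth_vf_p: "smooth (vf_p \<tau> f)" and smooth_vf_q: "smooth (vf_q \<tau> f)"
proof -
  note D = smooth_frechet_derivative[OF assms]
  have z: "smooth (\<lambda>w :: complex \<times> real. fst w)" "smooth (\<lambda>w :: complex \<times> real. cnj (fst w))"
    by (intro smooth_bounded_linear bounded_linear_fst
        bounded_linear_compose[OF bounded_linear_cnj bounded_linear_fst])+
  let ?x = "\<lambda>w. frechet_derivative f (at w) (1, 0)"
  let ?y = "\<lambda>w. frechet_derivative f (at w) (\<i>, 0)"
  let ?t = "\<lambda>w. frechet_derivative f (at w) (0, 1)"
  let ?c = "complex_of_real (sqrt (Im \<tau> / pi))"
  \<comment> \<open>Differences and quotients become sums and products with constants, the
    operations already known to preserve smoothness.\<close>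
  have "vf_p \<tau> f = (\<lambda>w. ?c * ((1/2) * (?x w + (- \<i>) * ?y w) + (\<i>/2) * cnj (fst w) * ?t w))"
    by (simp add: fun_eq_iff vf_defs field_simps)
  then show "smooth (vf_p \<tau> f)"
    by (simp only:) (intro smooth_mult smooth_add smooth_const D z)
  have "vf_q \<tau> f = (\<lambda>w. ?c * ((1/2) * (?x w + \<i> * ?y w) + (- \<i>/2) * fst w * ?t w))"
    by (simp add: fun_eq_iff vf_defs field_simps)
  then show "smooth (vf_q \<tau> f)"
    by (simp only:) (intro smooth_mult smooth_add smooth_const D z)
qed

lemma heis_mult: "x \<otimes>\<^bsub>heis\<^esub> h = (fst x + fst h, snd x + snd h + Im (cnj (fst x) * fst h))"
  by (simp add: heis_def split: prod.splits)

text \<open>This is the chain rule for \<open>f o R = f\<close>, where \<open>R\<close> is right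
  translation by \<open>h\<close>. The differential of \<open>R\<close> shears directions along the
  center, which produces the extra multiple of the t-derivative.\<close>

lemma frechet_derivative_invariant:
  fixes f :: "complex \<times> real \<Rightarrow> complex"
  assumes f: "\<And>x. f differentiable (at x)" and inv: "\<And>x. f (x \<otimes>\<^bsub>heis\<^esub> h) = f x"
  shows "frechet_derivative f (at x) v = frechet_derivative f (at (x \<otimes>\<^bsub>heis\<^esub> h)) (fst v, 0) +
    complex_of_real (snd v + Im (cnj (fst v) * fst h)) *
      frechet_derivative f (at (x \<otimes>\<^bsub>heis\<^esub> h)) (0, 1)"
proof -
  define R where "R x = x \<otimes>\<^bsub>heis\<^esub> h" for x
  define D where "D = frechet_derivative f (at (R x))"
  have R: "(R has_derivative (\<lambda>v. (fst v, snd v + Im (cnj (fst v) * fst h)))) (at x)"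
    unfolding R_def heis_mult by (auto intro!: derivative_eq_intros)
  have D: "(f has_derivative D) (at (R x))"
    using f by (simp add: D_def flip: frechet_derivative_works)
  have "f \<circ> R = f"
    using inv by (simp add: R_def fun_eq_iff)
  with diff_chain_at[OF R D]
  have "frechet_derivative f (at x) v = D (fst v, snd v + Im (cnj (fst v) * fst h))"
    by (metis (no_types, lifting) comp_apply frechet_derivative_at)
  also have "(fst v, snd v + Im (cnj (fst v) * fst h)) =
      (fst v, 0) + (snd v + Im (cnj (fst v) * fst h)) *\<^sub>R (0 :: complex, 1 :: real)"
    by simp
  also have "D \<dots> = D (fst v, 0) + (snd v + Im (cnj (fst v) * fst h)) *\<^sub>R D (0, 1)"
    using has_derivative_linear[OF D] by (simp only: linear_add linear_scale)
  finally show ?thesis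
    by (simp add: D_def R_def scaleR_conv_of_real)
qed

text \<open>The multiples of the t-derivative that the shear adds to the x- and y-derivatives are
  compensated exactly by the shift of the t-coefficient, by \<open>cnj (fst h)\<close> for p and by
  \<open>fst h\<close> for q. This works for every group element \<open>h\<close>, not only for
  lattice elements.\<close>

lemma vf_invariant:
  assumes "\<And>x. f differentiable (at x)" "\<And>x. f (x \<otimes>\<^bsub>heis\<^esub> h) = f x"
  shows vf_p_invariant: "vf_p \<tau> f (x \<otimes>\<^bsub>heis\<^esub> h) = vf_p \<tau> f x"
    and vf_q_invariant: "vf_q \<tau> f (x \<otimes>\<^bsub>heis\<^esub> h) = vf_q \<tau> f x"
proof -
  note inv = frechet_derivative_invariant[of f h x, OF assms]
  let ?y = "x \<otimes>\<^bsub>heis\<^esub> h"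
  define X where "X = frechet_derivative f (at ?y) (1, 0)"
  define Y where "Y = frechet_derivative f (at ?y) (\<i>, 0)"
  define T where "T = frechet_derivative f (at ?y) (0, 1)"
  \<comment> \<open>In direction \<open>(0, 1)\<close> the general formula leaves a derivative in
    direction \<open>(0, 0)\<close>, which vanishes by linearity.\<close>
  define D0 where "D0 = frechet_derivative f (at ?y) (0, 0)"
  have D0: "D0 = 0"
    using has_derivative_linear[OF assms(1)[of ?y, unfolded frechet_derivative_works]]
    by (metis D0_def linear_0 zero_prod_def)
  have x: "frechet_derivative f (at x) (1, 0) = X + Im (fst h) * T"
    and y: "frechet_derivative f (at x) (\<i>, 0) = Y - Re (fst h) * T"
    and t: "frechet_derivative f (at x) (0, 1) = T"
    by (simp_all only: inv X_def[symmetric] Y_def[symmetric] T_def[symmetric] D0_def[symmetric]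
        fst_conv) (simp_all add: D0)
  have fst: "fst ?y = fst x + fst h"
    by (simp add: heis_mult)
  \<comment> \<open>Written this way, the shift of the t-coefficient matches the shear terms:
    \<open>Im (fst h)\<close> comes from the x-derivative and \<open>Re (fst h)\<close> from the
    y-derivative.\<close>
  have cnj: "\<i> * cnj (fst h) = Im (fst h) + \<i> * Re (fst h)"
    and h: "\<i> * fst h = - Im (fst h) + \<i> * Re (fst h)"
    by (simp_all add: complex_eq_iff)
  have "\<i> * cnj (fst x + fst h) * T = \<i> * cnj (fst x) * T + (Im (fst h) + \<i> * Re (fst h)) * T"
    unfolding cnj [symmetric] by (simp add: algebra_simps)
  then have p: "(X - \<i> * Y) / 2 + \<i> * cnj (fst x + fst h) / 2 * T =
      (X + Im (fst h) * T - \<i> * (Y - Re (fst h) * T)) / 2 + \<i> * cnj (fst x) / 2 * T"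
    by (simp add: field_simps)
  show "vf_p \<tau> f ?y = vf_p \<tau> f x"
    unfolding vf_defs x y t fst X_def[symmetric] Y_def[symmetric] T_def[symmetric] p ..
  have ih: "\<i> * (fst x + fst h) = \<i> * fst x + (- Im (fst h) + \<i> * Re (fst h))"
    unfolding h [symmetric] by (simp add: algebra_simps)
  have q: "(X + \<i> * Y) / 2 - \<i> * (fst x + fst h) / 2 * T =
      (X + Im (fst h) * T + \<i> * (Y - Re (fst h) * T)) / 2 - \<i> * fst x / 2 * T"
    unfolding ih by (simp add: field_simps)
  show "vf_q \<tau> f ?y = vf_q \<tau> f x"
    unfolding vf_defs x y t fst X_def[symmetric] Y_def[symmetric] T_def[symmetric] q ..
qed


section \<open>Formal power series over function algebras\<close>

text \<open>Shared by \<open>A_smooth\<close> and \<open>A_hol\<close>, so that closure of the power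
  series over them is proved only once.\<close>

definition function_algebra :: "('c \<Rightarrow> complex) set \<Rightarrow> bool" where
  "function_algebra V \<longleftrightarrow> 0 \<in> V \<and> (\<forall>f\<in>V. \<forall>g\<in>V. f + g \<in> V \<and> f * g \<in> V) \<and>
     (\<forall>c. \<forall>f\<in>V. (\<lambda>w. c * f w) \<in> V)"

text \<open>Linearity is relative to \<open>V\<close> because \<open>frechet_derivative\<close> is
  unspecified where a function is not differentiable. Invariance of \<open>V\<close> is included so
  that powers of \<open>L\<close> are again such operators.\<close>

definition linear_operator :: "('c \<Rightarrow> complex) set \<Rightarrow> (('c \<Rightarrow> complex) \<Rightarrow> 'c \<Rightarrow> complex) \<Rightarrow> bool"
  where
  "linear_operator V L \<longleftrightarrow> (\<forall>f\<in>V. L f \<in> V) \<and> (\<forall>f\<in>V. \<forall>g\<in>V. L (f + g) = L f + L g) \<and>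
     (\<forall>c. \<forall>f\<in>V. L (\<lambda>w. c * f w) = (\<lambda>w. c * L f w))"

lemma linear_operator_funpow: "linear_operator V L \<Longrightarrow> linear_operator V (L ^^ j)"
  by (induction j) (auto simp: linear_operator_def)

lemma function_algebra_sum:
  assumes "function_algebra V" "\<And>i. i \<in> S \<Longrightarrow> f i \<in> V"
  shows "sum f S \<in> V"
  using assms(2)
  by (induction S rule: infinite_finite_induct) (use assms(1) in \<open>auto simp: function_algebra_def\<close>)

lemma linear_operator_sum:
  assumes V: "function_algebra V" and L: "linear_operator V L" and "\<And>i. i \<in> S \<Longrightarrow> f i \<in> V"
  shows "L (sum f S) = (\<Sum>i\<in>S. L (f i))"
proof -
  \<comment> \<open>Needed for the empty sum, and for infinite \<open>S\<close>, where
    \<open>sum\<close> is 0 by default.\<close>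
  have L0: "L 0 = 0"
  proof -
    have "0 \<in> V" using V by (simp add: function_algebra_def)
    then have "L (0 + 0) = L 0 + L 0"
      using L unfolding linear_operator_def by blast
    then show ?thesis by simp
  qed
  show ?thesis
    using assms(3)
  proof (induction S rule: infinite_finite_induct)
    case (insert x F)
    then have "f x \<in> V" "sum f F \<in> V"
      by (auto intro: function_algebra_sum[OF V])
    then have "L (f x + sum f F) = L (f x) + L (sum f F)"
      using L unfolding linear_operator_def by blast
    with insert show ?case
      by (simp only: sum.insert insert_iff simp_thms)
  qed (simp_all add: L0)
qed

(* As a sum of functions rather than as a function, to which linear operators can be applied. *)
lemma fps_nth_fps_scale_sum:
  "fps_nth (fps_scale s a) n = (\<Sum>i=0..n. (\<lambda>w. fps_nth s i * fps_nth a (n - i) w))"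
  by (simp add: fps_nth_fps_scale fun_eq_iff sum_fun_apply)

lemma fps_over_closed:
  assumes V: "function_algebra V"
  shows fps_over_add: "a \<in> fps_over V \<Longrightarrow> b \<in> fps_over V \<Longrightarrow> a + b \<in> fps_over V"
    and fps_over_mult: "a \<in> fps_over V \<Longrightarrow> b \<in> fps_over V \<Longrightarrow> a * b \<in> fps_over V"
    and fps_over_scale: "a \<in> fps_over V \<Longrightarrow> fps_scale s a \<in> fps_over V"
    and fps_over_zero: "0 \<in> fps_over V"
  using V
  by (auto simp: fps_over_def fps_mult_nth fps_nth_fps_scale_sum
      intro!: function_algebra_sum[OF V]) (auto simp: function_algebra_def)

text \<open>Each coefficient of \<open>fps_scale s a\<close> is a finite linear combination of
  coefficients of \<open>a\<close>. Hence complex linearity of \<open>L\<close> on \<open>V\<close>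
  already gives linearity over complex power series.\<close>

lemma fps_map_linear_operator:
  assumes V: "function_algebra V" and L: "linear_operator V L" and a: "a \<in> fps_over V"
  shows fps_map_in: "fps_map L a \<in> fps_over V"
    and fps_map_add: "b \<in> fps_over V \<Longrightarrow> fps_map L (a + b) = fps_map L a + fps_map L b"
    and fps_map_scale: "fps_map L (fps_scale s a) = fps_scale s (fps_map L a)"
proof -
  show "fps_map L a \<in> fps_over V"
    and "b \<in> fps_over V \<Longrightarrow> fps_map L (a + b) = fps_map L a + fps_map L b"
    using L a by (auto simp: fps_map_def fps_over_def linear_operator_def fps_eq_iff)
  show "fps_map L (fps_scale s a) = fps_scale s (fps_map L a)"
  proof (rule fps_ext)
    fix n
    have "L (\<Sum>i=0..n. (\<lambda>w. fps_nth s i * fps_nth a (n - i) w)) =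
        (\<Sum>i=0..n. L (\<lambda>w. fps_nth s i * fps_nth a (n - i) w))"
      using V a by (intro linear_operator_sum[OF V L]) (auto simp: fps_over_def function_algebra_def)
    also have "\<dots> = (\<Sum>i=0..n. (\<lambda>w. fps_nth s i * L (fps_nth a (n - i)) w))"
      using L a by (intro sum.cong) (auto simp: fps_over_def linear_operator_def)
    finally show "fps_nth (fps_map L (fps_scale s a)) n = fps_nth (fps_scale s (fps_map L a)) n"
      by (simp add: fps_map_def fps_nth_fps_scale_sum)
  qed
qed

lemma fps_scale_mult_left: "fps_scale s a * b = fps_scale s (a * b)"
  by (simp add: fps_scale_def mult.assoc)

lemma fps_scale_mult_right: "a * fps_scale s b = fps_scale s (a * b)"
  by (simp add: fps_scale_def mult.left_commute)

lemma fps_scale_commute: "fps_scale s (fps_scale r a) = fps_scale r (fps_scale s a)"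
  by (simp add: fps_scale_def mult.left_commute)


section \<open>The star product\<close>

text \<open>Since \<theta> is divisible by the formal parameter, the terms with \<open>j > n\<close>
  do not reach order \<open>n\<close>. The infinite sum thus becomes finite in each coefficient, and
  identities can be checked term by term.\<close>

lemma fps_nth_star:
  "\<theta> \<in> Theta \<Longrightarrow> fps_nth (star \<tau> \<theta> a b) n = (\<Sum>j\<le>n. fps_nth (star_term \<tau> \<theta> a b j) n)"
  unfolding star_def by (simp flip: sums_unique[OF star_sums])

text \<open>Because p and q preserve \<open>V\<close>, all their powers are linear on it. Each
  \<open>star_term\<close> is therefore bilinear with values over \<open>V\<close>, and this passes
  to the coefficientwise finite sums.\<close>

lemma algebra_on_star:
  assumes \<theta>: "\<theta> \<in> Theta" and V: "function_algebra V"
    and p: "linear_operator V (vf_p \<tau>)" and q: "linear_operator V (vf_q \<tau>)"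
  shows "algebra_on fps_scale (star \<tau> \<theta>) (fps_over V)"
proof -
  note pj = linear_operator_funpow[OF p] and qj = linear_operator_funpow[OF q]
  note P = fps_map_linear_operator[OF V pj] and Q = fps_map_linear_operator[OF V qj]
  note scale_add = module.scale_right_distrib[OF module_fps_scale]
  have sub: "module.subspace fps_scale (fps_over V)"
    unfolding module.subspace_def[OF module_fps_scale]
    by (auto intro: fps_over_closed[OF V])
  have closed: "star \<tau> \<theta> a b \<in> fps_over V" if "a \<in> fps_over V" "b \<in> fps_over V" for a b
  proof -
    have "star_term \<tau> \<theta> a b j \<in> fps_over V" for j
      unfolding star_term_def using that by (intro fps_over_closed[OF V] P(1) Q(1))
    then show ?thesis
      by (auto simp: fps_over_def fps_nth_star[OF \<theta>] intro!: function_algebra_sum[OF V])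
  qed
  have add: "star \<tau> \<theta> (a + b) c = star \<tau> \<theta> a c + star \<tau> \<theta> b c"
    "star \<tau> \<theta> a (b + c) = star \<tau> \<theta> a b + star \<tau> \<theta> a c"
    if "a \<in> fps_over V" "b \<in> fps_over V" "c \<in> fps_over V" for a b c
  proof -
    have "star_term \<tau> \<theta> (a + b) c j = star_term \<tau> \<theta> a c j + star_term \<tau> \<theta> b c j"
      "star_term \<tau> \<theta> a (b + c) j = star_term \<tau> \<theta> a b j + star_term \<tau> \<theta> a c j" for j
      using that by (simp_all add: star_term_def P(2) Q(2) distrib_left distrib_right scale_add)
    then show "star \<tau> \<theta> (a + b) c = star \<tau> \<theta> a c + star \<tau> \<theta> b c"
      "star \<tau> \<theta> a (b + c) = star \<tau> \<theta> a b + star \<tau> \<theta> a c"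
      by (simp_all add: fps_eq_iff fps_nth_star[OF \<theta>] sum.distrib)
  qed
  have scale: "star \<tau> \<theta> (fps_scale s a) b = fps_scale s (star \<tau> \<theta> a b)"
    "star \<tau> \<theta> a (fps_scale s b) = fps_scale s (star \<tau> \<theta> a b)"
    if "a \<in> fps_over V" "b \<in> fps_over V" for s a b
  proof -
    have terms: "star_term \<tau> \<theta> (fps_scale s a) b j = fps_scale s (star_term \<tau> \<theta> a b j)"
      "star_term \<tau> \<theta> a (fps_scale s b) j = fps_scale s (star_term \<tau> \<theta> a b j)" for j
      using that by (simp_all add: star_term_def P(3) Q(3) fps_scale_mult_left
          fps_scale_mult_right fps_scale_commute[of s])
    \<comment> \<open>Terms with \<open>j > n\<close> vanish at order \<open>m \<le> n\<close>, so the partial sum up to \<open>n\<close> may be used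
      for all coefficients entering the convolution with \<open>s\<close>.\<close>
    have star_nth: "fps_nth (star \<tau> \<theta> a b) m = fps_nth (\<Sum>j\<le>n. star_term \<tau> \<theta> a b j) m"
      if "m \<le> n" for m n
      unfolding fps_nth_star[OF \<theta>] fps_sum_nth
      by (rule sum.mono_neutral_left) (use that \<theta> in \<open>auto intro!: fps_nth_star_term\<close>)
    have scale_nth: "fps_nth (fps_scale s (star \<tau> \<theta> a b)) n =
        (\<Sum>j\<le>n. fps_nth (fps_scale s (star_term \<tau> \<theta> a b j)) n)" for n
    proof -
      have "fps_nth (fps_scale s (star \<tau> \<theta> a b)) n =
          fps_nth (fps_scale s (\<Sum>j\<le>n. star_term \<tau> \<theta> a b j)) n"
        by (simp add: fps_nth_fps_scale star_nth[where n = n])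
      then show ?thesis
        by (simp add: module.scale_sum_right[OF module_fps_scale] fps_sum_nth)
    qed
    show "star \<tau> \<theta> (fps_scale s a) b = fps_scale s (star \<tau> \<theta> a b)"
      "star \<tau> \<theta> a (fps_scale s b) = fps_scale s (star \<tau> \<theta> a b)"
      by (simp_all add: fps_eq_iff scale_nth fps_nth_star[OF \<theta>] terms)
  qed
  show ?thesis
    unfolding algebra_on_def
    by (intro conjI ballI allI module_fps_scale sub closed add scale)
qed

text \<open>Only the right factor is differentiated by q, so \<open>a\<close> is arbitrary. The
  surviving term \<open>j = 0\<close> has scalar factor 1 and no derivatives.\<close>

lemma star_eq_mult:
  assumes \<theta>: "\<theta> \<in> Theta" and b: "\<And>n. vf_q \<tau> (fps_nth b n) = 0"
  shows "star \<tau> \<theta> a b = a * b"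
proof -
  have "(vf_q \<tau> ^^ Suc j) (fps_nth b n) = 0" for j n
    by (induction j) (simp_all add: b vf_q_zero del: zero_fun_apply)
  then have "fps_map (vf_q \<tau> ^^ Suc j) b = 0" for j
    by (simp add: fps_map_def fps_eq_iff)
  then have *: "star_term \<tau> \<theta> a b j = (if j = 0 then a * b else 0)" for j
  proof (cases j)
    case 0
    have "fps_map id c = c" for c :: "(complex \<times> real \<Rightarrow> complex) fps"
      by (simp add: fps_map_def fps_eq_iff)
    with 0 show ?thesis
      by (simp add: star_term_def module.scale_one[OF module_fps_scale] flip: id_def)
  next
    case Suc
    with \<open>\<And>j. fps_map (vf_q \<tau> ^^ Suc j) b = 0\<close> show ?thesis
      by (simp add: star_term_def module.scale_zero_right[OF module_fps_scale] del: funpow.simps)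
  qed
  show ?thesis
    by (rule fps_ext)
       (simp add: fps_nth_star[OF \<theta>] * if_distrib[of "\<lambda>x. fps_nth x _"] cong: if_cong)
qed


section \<open>Smooth and holomorphic functions on the nilmanifold\<close>

lemma A_smooth_imp_smooth: "f \<in> A_smooth \<tau> \<Longrightarrow> smooth f"
  by (simp add: A_smooth_def)

lemma function_algebra_A_smooth: "function_algebra (A_smooth \<tau>)"
  by (auto simp: function_algebra_def A_smooth_def zero_fun_def plus_fun_def times_fun_def
      intro: smooth_const smooth_add smooth_mult)

text \<open>Commutation with all right translations, applied to the lattice elements, keeps the
  results in \<open>A_smooth\<close>.\<close>

lemma linear_operator_vf:
  shows linear_operator_vf_p: "linear_operator (A_smooth \<tau>) (vf_p \<tau>)"
    and linear_operator_vf_q: "linear_operator (A_smooth \<tau>) (vf_q \<tau>)"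
proof -
  have "vf_p \<tau> f \<in> A_smooth \<tau>" "vf_q \<tau> f \<in> A_smooth \<tau>" if "f \<in> A_smooth \<tau>" for f
    unfolding A_smooth_def
    using that vf_invariant[of f _ \<tau>, OF smooth_imp_differentiable]
    by (simp_all add: A_smooth_def smooth_vf del: split_paired_All)
  then show "linear_operator (A_smooth \<tau>) (vf_p \<tau>)" "linear_operator (A_smooth \<tau>) (vf_q \<tau>)"
    by (simp_all add: linear_operator_def vf_add vf_scale A_smooth_imp_smooth)
qed

text \<open>The kernel of a linear derivation is a subalgebra: by the Leibniz rule both summands of
  q(fg) vanish.\<close>

lemma function_algebra_A_hol: "function_algebra (A_hol \<tau>)"
  using function_algebra_A_smooth[of \<tau>]
  by (auto simp: function_algebra_def A_hol_def vf_q_zero vf_q_add vf_q_mult vf_q_scale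
      A_smooth_imp_smooth fun_eq_iff[of "vf_q \<tau> _"])

(* [p, q] = t does not vanish on the kernel of q, so p need not preserve A_hol and algebra_on_star
   cannot be applied to it. *)
lemma subalgebra_onI:
  assumes "algebra_on act m V" "W \<subseteq> V" "module.subspace act W"
    and "\<And>a b. a \<in> W \<Longrightarrow> b \<in> W \<Longrightarrow> m a b \<in> W"
  shows "subalgebra_on act m W V"
  using assms unfolding subalgebra_on_def algebra_on_def by (meson subsetD)

theorem mainTheorem5:
  fixes \<tau> :: complex and \<theta> :: "complex fps"
  assumes "Im \<tau> > 0" and "\<theta> \<in> Theta"
  shows "(\<forall>a\<in>fps_over (A_hol \<tau>). \<forall>b\<in>fps_over (A_hol \<tau>). star \<tau> \<theta> a b = a * b) \<and>
    subalgebra_on fps_scale (star \<tau> \<theta>) (fps_over (A_hol \<tau>)) (fps_over (A_smooth \<tau>)) \<and>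
    (\<forall>a\<in>fps_over (A_hol \<tau>). \<forall>b\<in>fps_over (A_hol \<tau>). star \<tau> \<theta> a b = star \<tau> \<theta> b a) \<and>
    (\<forall>a\<in>fps_over (A_hol \<tau>). \<forall>b\<in>fps_over (A_hol \<tau>). \<forall>c\<in>fps_over (A_hol \<tau>).
       star \<tau> \<theta> (star \<tau> \<theta> a b) c = star \<tau> \<theta> a (star \<tau> \<theta> b c))"
proof -
  let ?H = "fps_over (A_hol \<tau>)"
  note H = fps_over_closed[OF function_algebra_A_hol[of \<tau>]]
  have star: "star \<tau> \<theta> a b = a * b" if "b \<in> ?H" for a b
    using that by (intro star_eq_mult[OF assms(2)]) (simp add: fps_over_def A_hol_def)
  have "subalgebra_on fps_scale (star \<tau> \<theta>) ?H (fps_over (A_smooth \<tau>))"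
  proof (rule subalgebra_onI)
    show "algebra_on fps_scale (star \<tau> \<theta>) (fps_over (A_smooth \<tau>))"
      by (intro algebra_on_star assms function_algebra_A_smooth linear_operator_vf)
    show "?H \<subseteq> fps_over (A_smooth \<tau>)"
      by (auto simp: fps_over_def A_hol_def)
    show "module.subspace fps_scale ?H"
      unfolding module.subspace_def[OF module_fps_scale] by (auto intro: H)
  qed (simp add: star H)
  \<comment> \<open>In the associativity law the right factor
    \<open>star \<tau> \<theta> b c\<close> is \<open>b * c\<close>, which lies in \<open>?H\<close>
    by closure under products, so the outer product is pointwise too.\<close>
  then show ?thesis
    by (simp add: star H mult.commute mult.assoc)
qed

end
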